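(* Let $\mathbf{A}$ be any (possibly empty) composition of the operators $\mathbf{S}$ and $\mathbf{R}$. Then for every $n$, the number of permutations of $[n]$ sorted by $\mathbf{S}\circ\mathbf{A}$ equals the number of permutations of $[n]$ sorted by $\mathbf{S}\circ\mathbf{R}\circ\mathbf{A}$. Moreover, the following statistics are equidistributed across these two sets: the number and positions of the right-to-left maxima, the number and positions of the left-to-right maxima, and the up-down word (hence every statistic determined by the up-down word). If $\mathbf{A}=\mathbf{A}_0\circ\mathbf{S}$ for some composition $\mathbf{A}_0$ of operators from $\{\mathbf{S},\mathbf{R}\}$, the statistic $\mathrm{zeil}$ is also equidistributed. If $\mathbf{A}=\mathbf{B}_0\circ\mathbf{S}\circ\mathbf{R}\circ\mathbf{S}^k$ for some composition $\mathbf{B}_0$ and some $k\ge 1$, the statistic $\mathrm{Rzeil}$ is also equidistributed. More precisely, the map $\Phi_{\mathbf{A}}$ is a size-preserving bijection from the set of permutations sorted by $\mathbf{S}\circ\mathbf{A}$ onto the set of permutations sorted by $\mathbf{S}\circ\mathbf{R}\circ\mathbf{A}$, and it preserves each of the statistics listed above, under the corresponding hypotheses on $\mathbf{A}$.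
   Context: Notation and conventions. - Permutations of $[n]=\{1,\dots,n\}$ are written in one-line notation $\sigma=\sigma(1)\cdots\sigma(n)$, and composition is $(\lambda\circ\sigma)(i)=\lambda(\sigma(i))$. - A sequence of distinct integers is identified with the permutation order-isomorphic to it; $n$ denotes the maximum entry. - $\sigma$ contains the pattern $\pi$ of size $k$ if there exist indices $i_1<\dots<i_k$ such that $\sigma(i_1)\cdots\sigma(i_k)$ is order-isomorphic to $\pi$; otherwise $\sigma$ avoids $\pi$. $\mathrm{Av}(B)$ is the set of permutations avoiding every pattern in $B$. Operators. - The stack-sorting operator is defined by $\mathbf{S}(\varepsilon)=\varepsilon$ and $\mathbf{S}(\alpha n\beta)=\mathbf{S}(\alpha)\mathbf{S}(\beta)n$, where $n$ is the maximum entry. - $\mathbf{R}$ is reversal: $\mathbf{R}(\sigma)(i)=\sigma(n+1-i)$. - A composition of operators from $\{\mathbf{S},\mathbf{R}\}$ is any finite composition of them; the empty composition is the identity. - A permutation $\theta$ is sorted by $\mathbf{S}\circ\mathbf{A}$ if $\mathbf{S}(\mathbf{A}(\theta))$ is the identity permutation. By Knuth, $\mathbf{S}(\sigma)$ is the identity iff $\sigma\in\mathrm{Av}(231)$. The bijection $P$. - For $\alpha$ of size $a$ and $\beta$ of size $b$: $\alpha\oplus\beta=\alpha\,(\beta+a)$ and $\alpha\ominus\beta=(\alpha+b)\,\beta$, where $\beta+a$ adds $a$ to every entry. - Every nonempty $\pi\in\mathrm{Av}(231)$ is uniquely $\alpha\oplus(1\ominus\beta)$ with $\alpha,\beta\in\mathrm{Av}(231)$,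 possibly empty. - $P:\mathrm{Av}(231)\to\mathrm{Av}(132)$ is defined by $P(\varepsilon)=\varepsilon$ and $P(\alpha\oplus(1\ominus\beta))=(P(\alpha)\oplus 1)\ominus P(\beta)$. - For $\pi\in\mathrm{Av}(231)$ of size $n$, $\lambda_\pi$ is the permutation of $[n]$ with $P(\pi)=\lambda_\pi\circ\pi$. - For $\theta$ sorted by $\mathbf{S}\circ\mathbf{A}$, so that $\mathbf{A}(\theta)\in\mathrm{Av}(231)$, set $\Phi_{\mathbf{A}}(\theta)=\lambda_{\mathbf{A}(\theta)}\circ\theta$. Statistics. - A left-to-right (resp. right-to-left) maximum of $\pi$ is an entry $\pi(i)$ larger than all $\pi(j)$ with $j<i$ (resp. $j>i$). - The up-down word of $\pi$ is $w\in\{u,d\}^{n-1}$ with $w(i)=u$ if $\pi(i)<\pi(i+1)$ and $w(i)=d$ otherwise. - $\mathrm{zeil}(\pi)=\max\{k : n(n-1)\cdots(n-k+1)\text{ is a subsequence of }\pi\}$ and $\mathrm{Rzeil}(\pi)=\max\{k : (n-k+1)\cdots(n-1)n\text{ is a subsequence of }\pi\}$. *)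

theory Defs
  imports "HOL-Combinatorics.Multiset_Permutations" "HOL-Library.Sublist"
begin

section \<open>Permutations and patterns\<close>

text \<open>Permutations of \<open>[n]\<close> are lists in one-line notation; list positions are counted
  from 0, entries from 1.\<close>

definition perms :: "nat list set" where
  "perms = {\<pi>. \<pi> \<in> permutations_of_set {1..length \<pi>}}"

definition order_isomorphic :: "nat list \<Rightarrow> nat list \<Rightarrow> bool" where
  "order_isomorphic xs ys \<longleftrightarrow>
     length xs = length ys \<and>
     (\<forall>i<length xs. \<forall>j<length xs. xs ! i < xs ! j \<longleftrightarrow> ys ! i < ys ! j)"

definition contains_pattern :: "nat list \<Rightarrow> nat list \<Rightarrow> bool" where
  "contains_pattern \<sigma> \<pi> \<longleftrightarrow> (\<exists>\<tau>. subseq \<tau> \<sigma> \<and> order_isomorphic \<tau> \<pi>)"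

definition Av :: "nat list set \<Rightarrow> nat list set" where
  "Av B = {\<sigma> \<in> perms. \<forall>\<pi>\<in>B. \<not> contains_pattern \<sigma> \<pi>}"


section \<open>Operators\<close>

text \<open>The parts of a sequence before and after its (first) maximum \<open>n\<close>: these are
  \<open>\<alpha>\<close> and \<open>\<beta>\<close> in \<open>\<alpha> n \<beta>\<close>.\<close>

definition before_max :: "nat list \<Rightarrow> nat list" where
  "before_max xs = takeWhile (\<lambda>x. x \<noteq> Max (set xs)) xs"

definition after_max :: "nat list \<Rightarrow> nat list" where
  "after_max xs = tl (dropWhile (\<lambda>x. x \<noteq> Max (set xs)) xs)"

lemma split_at_max:
  assumes "xs \<noteq> []"
  shows "xs = before_max xs @ Max (set xs) # after_max xs"
proof -
  have "\<exists>x\<in>set xs. x = Max (set xs)"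
    using assms by (metis List.finite_set Max_in set_empty)
  hence "dropWhile (\<lambda>x. x \<noteq> Max (set xs)) xs \<noteq> []"
    by (metis (mono_tags, lifting) dropWhile_eq_Nil_conv)
  hence "dropWhile (\<lambda>x. x \<noteq> Max (set xs)) xs = Max (set xs) # after_max xs"
    unfolding after_max_def using hd_dropWhile list.collapse by (metis (mono_tags, lifting))
  thus ?thesis
    unfolding before_max_def by (metis takeWhile_dropWhile_id)
qed

lemma before_max_append [simp]:
  assumes "\<forall>x\<in>set \<alpha> \<union> set \<beta>. x < n"
  shows "before_max (\<alpha> @ n # \<beta>) = \<alpha>"
proof -
  have "Max (set (\<alpha> @ n # \<beta>)) = n"
    using assms by (intro Max_eqI) (auto simp: less_imp_le)
  thus ?thesis
    using assms by (auto simp: before_max_def takeWhile_append)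
qed

lemma after_max_append [simp]:
  assumes "\<forall>x\<in>set \<alpha> \<union> set \<beta>. x < n"
  shows "after_max (\<alpha> @ n # \<beta>) = \<beta>"
proof -
  have "Max (set (\<alpha> @ n # \<beta>)) = n"
    using assms by (intro Max_eqI) (auto simp: less_imp_le)
  thus ?thesis
    using assms by (auto simp: after_max_def dropWhile_append)
qed

lemma length_before_max: "xs \<noteq> [] \<Longrightarrow> length (before_max xs) < length xs"
  by (metis split_at_max length_append length_Cons less_add_Suc1 add_Suc_right)

lemma length_after_max: "xs \<noteq> [] \<Longrightarrow> length (after_max xs) < length xs"
  by (metis split_at_max length_append length_Cons less_add_Suc2 add_Suc_right)

function stack_sort :: "nat list \<Rightarrow> nat list" where
  "stack_sort xs =
     (if xs = [] then []
      else stack_sort (before_max xs) @ stack_sort (after_max xs) @ [Max (set xs)])"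
  by auto
termination
  by (relation "measure length") (auto simp: length_before_max length_after_max)

declare stack_sort.simps [simp del]

lemma stack_sort_Nil: "stack_sort [] = []"
  by (simp add: stack_sort.simps)

lemma stack_sort_append:
  assumes "\<forall>x\<in>set \<alpha> \<union> set \<beta>. x < n"
  shows "stack_sort (\<alpha> @ n # \<beta>) = stack_sort \<alpha> @ stack_sort \<beta> @ [n]"
proof -
  have "Max (set (\<alpha> @ n # \<beta>)) = n"
    using assms by (intro Max_eqI) (auto simp: less_imp_le)
  thus ?thesis
    using assms by (subst stack_sort.simps) simp
qed

text \<open>Finite compositions of stack sorting \<open>S\<close> and reversal \<open>R = rev\<close>.\<close>

inductive_set compositions :: "(nat list \<Rightarrow> nat list) set" where
  empty: "id \<in> compositions"
| S: "A \<in> compositions \<Longrightarrow> stack_sort \<circ> A \<in> compositions"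
| R: "A \<in> compositions \<Longrightarrow> rev \<circ> A \<in> compositions"

text \<open>Equality of operators as maps on permutations (values on other lists are irrelevant).\<close>

definition same_operator ::
    "(nat list \<Rightarrow> nat list) \<Rightarrow> (nat list \<Rightarrow> nat list) \<Rightarrow> bool" where
  "same_operator A B \<longleftrightarrow> (\<forall>\<theta>\<in>perms. A \<theta> = B \<theta>)"

definition sorted_by :: "(nat list \<Rightarrow> nat list) \<Rightarrow> nat list set" where
  "sorted_by F = {\<theta> \<in> perms. F \<theta> = [1..<Suc (length \<theta>)]}"


section \<open>The bijection \<open>P\<close> and the maps \<open>\<Phi>\<close>\<close>

definition osum :: "nat list \<Rightarrow> nat list \<Rightarrow> nat list"  (infixr "\<oplus>" 65) where
  "\<alpha> \<oplus> \<beta> = \<alpha> @ map (\<lambda>x. x + length \<alpha>) \<beta>"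

definition ominus :: "nat list \<Rightarrow> nat list \<Rightarrow> nat list"  (infixr "\<ominus>" 65) where
  "\<alpha> \<ominus> \<beta> = map (\<lambda>x. x + length \<beta>) \<alpha> @ \<beta>"

text \<open>In \<open>\<alpha> \<oplus> ([1] \<ominus> \<beta>)\<close> the entry \<open>1\<close> of the inner sum becomes the maximum, so \<open>\<alpha>\<close> is the
  part before the maximum, and the part after it is \<open>\<beta>\<close> shifted up by \<open>length \<alpha>\<close>.
  Only the values of \<open>Pmap\<close> on \<open>Av {[2, 3, 1]}\<close> are meaningful; there it is characterised by
  \<open>Pmap_Nil\<close>, \<open>Pmap_decomposition\<close> and \<open>Av_231_decomposition\<close> below.\<close>

function Pmap :: "nat list \<Rightarrow> nat list" where
  "Pmap \<pi> =
     (if \<pi> = [] then []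
      else (Pmap (before_max \<pi>) \<oplus> [1])
             \<ominus> Pmap (map (\<lambda>x. x - length (before_max \<pi>)) (after_max \<pi>)))"
  by auto
termination
  by (relation "measure length") (auto simp: length_before_max length_after_max)

declare Pmap.simps [simp del]

lemma Pmap_Nil: "Pmap [] = []"
  by (simp add: Pmap.simps)

lemma Pmap_decomposition:
  assumes "\<alpha> \<in> Av {[2, 3, 1]}" "\<beta> \<in> Av {[2, 3, 1]}"
  shows "Pmap (\<alpha> \<oplus> ([1] \<ominus> \<beta>)) = (Pmap \<alpha> \<oplus> [1]) \<ominus> Pmap \<beta>"
proof -
  let ?n = "1 + length \<beta> + length \<alpha>"
  let ?\<beta> = "map (\<lambda>x. x + length \<alpha>) \<beta>"
  have eq: "\<alpha> \<oplus> ([1] \<ominus> \<beta>) = \<alpha> @ ?n # ?\<beta>"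
    by (simp add: osum_def ominus_def)
  have "set \<alpha> = {1..length \<alpha>}" "set \<beta> = {1..length \<beta>}"
    using assms by (auto simp: Av_def perms_def permutations_of_set_def)
  hence bound: "\<forall>x\<in>set \<alpha> \<union> set ?\<beta>. x < ?n"
    by auto
  show ?thesis
    unfolding eq by (subst Pmap.simps)
      (simp del: add_Suc_right add_Suc add: before_max_append[OF bound, simplified]
        after_max_append[OF bound, simplified] comp_def)
qed

lemma Av_231_decomposition:
  assumes "\<pi> \<in> Av {[2, 3, 1]}" "\<pi> \<noteq> []"
  shows "\<exists>\<alpha>\<in>Av {[2, 3, 1]}. \<exists>\<beta>\<in>Av {[2, 3, 1]}. \<pi> = \<alpha> \<oplus> ([1] \<ominus> \<beta>)"
proof -
  define n where "n = length \<pi>"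
  define \<alpha> where "\<alpha> = before_max \<pi>"
  define \<gamma> where "\<gamma> = after_max \<pi>"
  define a where "a = length \<alpha>"
  define \<beta> where "\<beta> = map (\<lambda>x. x - a) \<gamma>"
  have set_\<pi>: "set \<pi> = {1..n}" and dist: "distinct \<pi>"
    and avoid: "\<not> contains_pattern \<pi> [2, 3, 1]"
    using assms by (auto simp: Av_def perms_def permutations_of_set_def n_def)
  have "n > 0"
    using assms by (simp add: n_def)
  hence "Max (set \<pi>) = n"
    unfolding set_\<pi> by (intro Max_eqI) auto
  hence split: "\<pi> = \<alpha> @ n # \<gamma>"
    using split_at_max[OF assms(2)] by (simp add: \<alpha>_def \<gamma>_def)
  have union: "set \<alpha> \<union> set \<gamma> = {1..n - 1}"
  proof -
    have "set \<alpha> \<union> set \<gamma> = set \<pi> - {n}"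
      using dist unfolding split by auto
    also have "\<dots> = {1..n - 1}"
      unfolding set_\<pi> by auto
    finally show ?thesis .
  qed
  have less: "x < y" if "x \<in> set \<alpha>" "y \<in> set \<gamma>" for x y
  proof (rule ccontr)
    assume "\<not> x < y"
    moreover have "x \<noteq> y"
      using that dist unfolding split by auto
    moreover have "x \<in> {1..n - 1}"
      using that union by blast
    ultimately have "y < x" "x < n"
      by auto
    hence "order_isomorphic [x, n, y] [2, 3, 1]"
      by (simp add: order_isomorphic_def All_less_Suc2)
    moreover have "subseq ([x] @ [n] @ [y]) (\<alpha> @ [n] @ \<gamma>)"
      using that by (intro list_emb_append_mono) (auto simp: subseq_singleton_left)
    ultimately show False
      using avoid unfolding contains_pattern_def split by auto
  qed
  have set_\<alpha>: "set \<alpha> = {1..a}"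
  proof -
    have closed: "y \<in> set \<alpha>" if "x \<in> set \<alpha>" "1 \<le> y" "y \<le> x" for x y
    proof -
      have "y \<in> set \<alpha> \<union> set \<gamma>"
        using that union by (metis UnI1 atLeastAtMost_iff le_trans)
      thus ?thesis
        using less[of x y] that by auto
    qed
    have "\<exists>m. set \<alpha> = {1..m}"
    proof (cases "\<alpha> = []")
      case True
      thus ?thesis by (intro exI[of _ 0]) auto
    next
      case False
      hence "Max (set \<alpha>) \<in> set \<alpha>" by simp
      hence "set \<alpha> = {1..Max (set \<alpha>)}"
      proof (intro equalityI subsetI)
        fix y assume "y \<in> set \<alpha>"
        moreover from this have "y \<in> {1..n - 1}"
          using union by blast
        ultimately show "y \<in> {1..Max (set \<alpha>)}" by simp
      next
        fix y assume "y \<in> {1..Max (set \<alpha>)}"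
        thus "y \<in> set \<alpha>"
          using closed[of "Max (set \<alpha>)" y] \<open>Max (set \<alpha>) \<in> set \<alpha>\<close> by simp
      qed
      thus ?thesis by blast
    qed
    then obtain m where m: "set \<alpha> = {1..m}" ..
    moreover have "card (set \<alpha>) = a"
      using dist unfolding split a_def by (simp add: distinct_card)
    ultimately show ?thesis by simp
  qed
  have n_eq: "n = Suc (a + length \<gamma>)"
    using arg_cong[OF split, of length] by (simp add: n_def a_def)
  have set_\<gamma>: "set \<gamma> = {Suc a..a + length \<gamma>}"
  proof -
    have "set \<alpha> \<inter> set \<gamma> = {}"
      using dist unfolding split by auto
    hence "set \<gamma> = {1..n - 1} - {1..a}"
      using union set_\<alpha> by blast
    also have "\<dots> = {Suc a..a + length \<gamma>}"
      unfolding n_eq by auto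
    finally show ?thesis .
  qed
  have \<gamma>: "\<gamma> = map (\<lambda>x. x + a) \<beta>"
    unfolding \<beta>_def map_map using set_\<gamma> by (intro map_idI[symmetric]) simp
  have dist_\<beta>: "distinct \<beta>"
    using dist unfolding split \<gamma> by (simp add: distinct_map)
  have set_\<beta>: "set \<beta> = {1..length \<beta>}"
  proof -
    have "(\<lambda>x. x + a) ` set \<beta> = (\<lambda>x. x + a) ` {1..length \<beta>}"
      using set_\<gamma> unfolding \<gamma> by (simp add: image_add_atLeastAtMost' add.commute)
    thus ?thesis
      by (subst (asm) inj_image_eq_iff) (auto simp: inj_def)
  qed
  have "subseq \<alpha> \<pi>" "subseq \<gamma> \<pi>"
    unfolding split by (auto intro: list_emb_append2)
  hence "\<not> contains_pattern \<alpha> [2, 3, 1]" and avoid_\<gamma>: "\<not> contains_pattern \<gamma> [2, 3, 1]"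
    using avoid unfolding contains_pattern_def by (meson subseq_order.trans)+
  moreover have "\<not> contains_pattern \<beta> [2, 3, 1]"
  proof
    assume "contains_pattern \<beta> [2, 3, 1]"
    then obtain \<tau> where \<tau>: "subseq \<tau> \<beta>" "order_isomorphic \<tau> [2, 3, 1]"
      by (auto simp: contains_pattern_def)
    have "subseq (map (\<lambda>x. x + a) \<tau>) \<gamma>"
      unfolding \<gamma> using \<tau>(1) by (rule subseq_map)
    moreover have "order_isomorphic (map (\<lambda>x. x + a) \<tau>) [2, 3, 1]"
      using \<tau>(2) by (auto simp: order_isomorphic_def)
    ultimately show False
      using avoid_\<gamma> by (auto simp: contains_pattern_def)
  qed
  moreover have "\<alpha> \<in> perms" "\<beta> \<in> perms"
    using dist dist_\<beta> set_\<alpha> set_\<beta> unfolding split perms_def permutations_of_set_def a_def by auto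
  ultimately have "\<alpha> \<in> Av {[2, 3, 1]}" "\<beta> \<in> Av {[2, 3, 1]}"
    by (auto simp: Av_def)
  moreover have "\<pi> = \<alpha> \<oplus> ([1] \<ominus> \<beta>)"
    using n_eq \<gamma> unfolding split osum_def ominus_def by (auto simp: a_def)
  ultimately show ?thesis by blast
qed

text \<open>\<open>\<lambda>\<^sub>\<pi>\<close>, as a permutation of \<open>[n]\<close> in the library sense (it fixes everything outside \<open>[n]\<close>).\<close>

definition lam :: "nat list \<Rightarrow> nat \<Rightarrow> nat" where
  "lam \<pi> = (THE l. l permutes {1..length \<pi>} \<and> Pmap \<pi> = map l \<pi>)"

definition Phi :: "(nat list \<Rightarrow> nat list) \<Rightarrow> nat list \<Rightarrow> nat list" where
  "Phi A \<theta> = map (lam (A \<theta>)) \<theta>"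


section \<open>Statistics\<close>

definition lr_max_positions :: "nat list \<Rightarrow> nat set" where
  "lr_max_positions \<pi> = {i. i < length \<pi> \<and> (\<forall>j<i. \<pi> ! j < \<pi> ! i)}"

definition rl_max_positions :: "nat list \<Rightarrow> nat set" where
  "rl_max_positions \<pi> =
     {i. i < length \<pi> \<and> (\<forall>j. i < j \<and> j < length \<pi> \<longrightarrow> \<pi> ! j < \<pi> ! i)}"

definition lr_max_count :: "nat list \<Rightarrow> nat" where
  "lr_max_count \<pi> = card (lr_max_positions \<pi>)"

definition rl_max_count :: "nat list \<Rightarrow> nat" where
  "rl_max_count \<pi> = card (rl_max_positions \<pi>)"

datatype step = Up | Down

definition updown_word :: "nat list \<Rightarrow> step list" where
  "updown_word \<pi> =
     map (\<lambda>i. if \<pi> ! i < \<pi> ! Suc i then Up else Down) [0..<length \<pi> - 1]"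

definition determined_by_updown :: "(nat list \<Rightarrow> 'a) \<Rightarrow> bool" where
  "determined_by_updown f \<longleftrightarrow>
     (\<forall>\<pi>\<in>perms. \<forall>\<sigma>\<in>perms.
        length \<pi> = length \<sigma> \<and> updown_word \<pi> = updown_word \<sigma> \<longrightarrow> f \<pi> = f \<sigma>)"

text \<open>The bound \<open>k \<le> n\<close> is needed since subtraction of naturals truncates.\<close>

definition zeil :: "nat list \<Rightarrow> nat" where
  "zeil \<pi> = Max {k. k \<le> length \<pi> \<and>
     subseq (rev [Suc (length \<pi>) - k..<Suc (length \<pi>)]) \<pi>}"

definition Rzeil :: "nat list \<Rightarrow> nat" where
  "Rzeil \<pi> = Max {k. k \<le> length \<pi> \<and>
     subseq [Suc (length \<pi>) - k..<Suc (length \<pi>)] \<pi>}"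

definition equidistributed :: "(nat list \<Rightarrow> 'a) \<Rightarrow> nat list set \<Rightarrow> nat list set \<Rightarrow> bool" where
  "equidistributed f X Y \<longleftrightarrow>
     (\<forall>n v. card {\<theta> \<in> X. length \<theta> = n \<and> f \<theta> = v} = card {\<theta> \<in> Y. length \<theta> = n \<and> f \<theta> = v})"

definition preserves :: "(nat list \<Rightarrow> nat list) \<Rightarrow> (nat list \<Rightarrow> 'a) \<Rightarrow> nat list set \<Rightarrow> bool" where
  "preserves g f X \<longleftrightarrow> (\<forall>\<theta>\<in>X. f (g \<theta>) = f \<theta>)"

end

theory Submission
  imports Defs
begin

text \<open>
  The map \<open>\<lambda>\<^sub>\<pi>\<close> preserves the relative order of two values whenever one is an ancestor of the other in
  the decreasing binary tree of \<open>\<pi>\<close>, because \<open>P\<close> does not change the shape of this tree. Ancestor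
  pairs of \<open>\<theta>\<close> remain ancestor pairs in \<open>S \<theta>\<close> and \<open>R \<theta>\<close>: a contiguous factor with maximum \<open>b\<close> is
  kept inside such a factor. Hence \<open>\<lambda>\<close> taken at \<open>\<pi> = A \<theta>\<close> preserves the tree shapes of \<open>\<theta>\<close> and of all
  intermediate sequences, so \<open>A\<close> commutes with it and \<open>A (\<Phi> \<theta>) = P (A \<theta>)\<close>. The shape determines the
  positions of the maxima and the up-down word. For \<open>zeil\<close> and \<open>Rzeil\<close>, one pass through \<open>S\<close> moves the
  relevant top entries to the end of the sequence, which forces \<open>\<lambda>\<close> to fix them.
\<close>

section \<open>Induction along the maximum, and entries under the operators\<close>

text \<open>The recursion of S at the maximum, as an induction rule. Distinctness makes the bounds
  strict, which is the form that \<open>stack_sort_append\<close> asks for.\<close>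

lemma distinct_max_induct [consumes 1, case_names Nil split]:
  assumes "distinct xs"
    and "P []"
    and "\<And>\<alpha> n \<beta>. distinct (\<alpha> @ n # \<beta>) \<Longrightarrow> \<forall>x\<in>set \<alpha> \<union> set \<beta>. x < n \<Longrightarrow> P \<alpha> \<Longrightarrow> P \<beta> \<Longrightarrow> P (\<alpha> @ n # \<beta>)"
  shows "P (xs :: nat list)"
  using assms(1)
proof (induction xs rule: length_induct)
  case (1 xs)
  show ?case
  proof (cases "xs = []")
    case False
    define \<alpha> n \<beta> where "\<alpha> = before_max xs" and "n = Max (set xs)" and "\<beta> = after_max xs"
    have xs: "xs = \<alpha> @ n # \<beta>"
      using split_at_max[OF False] by (simp add: \<alpha>_def n_def \<beta>_def)
    have "\<forall>x\<in>set \<alpha> \<union> set \<beta>. x < n"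
    proof
      fix x assume x: "x \<in> set \<alpha> \<union> set \<beta>"
      hence "x \<in> set xs" by (auto simp: xs)
      hence "x \<le> n" by (simp add: n_def)
      moreover have "x \<noteq> n" using x "1.prems" by (auto simp: xs)
      ultimately show "x < n" by simp
    qed
    moreover have "P \<alpha>" "P \<beta>"
      using "1.IH" "1.prems" by (simp_all add: xs)
    ultimately show ?thesis
      using assms(3) "1.prems" by (simp add: xs)
  qed (simp add: assms(2))
qed

lemma mset_stack_sort [simp]: "mset (stack_sort xs) = mset xs"
proof (induction xs rule: stack_sort.induct)
  case (1 xs)
  show ?case
  proof (cases "xs = []")
    case False
    have "mset xs = mset (before_max xs @ Max (set xs) # after_max xs)"
      using split_at_max[OF False] by simp
    thus ?thesis
      using 1 False by (subst stack_sort.simps) simp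
  qed (simp add: stack_sort_Nil)
qed

lemma set_stack_sort [simp]: "set (stack_sort xs) = set xs"
  by (metis mset_stack_sort set_mset_mset)

lemma length_stack_sort [simp]: "length (stack_sort xs) = length xs"
  by (metis mset_stack_sort size_mset)

lemma distinct_stack_sort [simp]: "distinct (stack_sort xs) = distinct xs"
  by (metis mset_stack_sort mset_eq_imp_distinct_iff)

lemma compositions_set_distinct:
  assumes "A \<in> compositions"
  shows "set (A xs) = set xs" "distinct (A xs) = distinct xs" "length (A xs) = length xs"
  using assms by (induction) auto


section \<open>Maps preserving the shape of the decreasing tree\<close>

text \<open>Read through the decreasing binary tree of \<open>xs\<close>: \<open>f\<close> is monotone on pairs of entries of
  which one is an ancestor of the other, so \<open>xs\<close> and \<open>map f xs\<close> have trees of the same shape.\<close>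

definition tree_mono :: "(nat \<Rightarrow> nat) \<Rightarrow> nat list \<Rightarrow> bool" where
  "tree_mono f xs \<longleftrightarrow>
     (\<forall>u. sublist u xs \<longrightarrow> (\<forall>a\<in>set u. \<forall>b\<in>set u. a < b \<longrightarrow> (\<forall>c\<in>set u. c \<le> b) \<longrightarrow> f a < f b))"

lemma tree_monoD:
  assumes "tree_mono f xs" "sublist u xs" "a \<in> set u" "b \<in> set u" "a < b" "\<And>c. c \<in> set u \<Longrightarrow> c \<le> b"
  shows "f a < f b"
  using assms unfolding tree_mono_def by blast

lemma tree_mono_sublist: "tree_mono f xs \<Longrightarrow> sublist ys xs \<Longrightarrow> tree_mono f ys"
  unfolding tree_mono_def by (meson sublist_order.order.trans)

lemma tree_mono_rev [simp]: "tree_mono f (rev xs) \<longleftrightarrow> tree_mono f xs"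
proof -
  have "tree_mono f (rev xs)" if "tree_mono f xs" for xs
    unfolding tree_mono_def
  proof (intro allI impI ballI)
    fix u a b
    assume "sublist u (rev xs)" "a \<in> set u" "b \<in> set u" "a < b" "\<forall>c\<in>set u. c \<le> b"
    thus "f a < f b"
      using tree_monoD[OF that, of "rev u" a b] by (simp add: sublist_rev_left)
  qed
  from this[of xs] this[of "rev xs"] show ?thesis by auto
qed

lemma tree_mono_strict_mono: "strict_mono f \<Longrightarrow> tree_mono f xs"
  by (auto simp: tree_mono_def strict_mono_def)

lemma sublist_around:
  assumes "sublist u (\<alpha> @ n # \<beta>)" "n \<notin> set u"
  shows "sublist u \<alpha> \<or> sublist u \<beta>"
  using assms by (fastforce simp: sublist_append sublist_Cons_right prefix_Cons suffix_imp_sublist prefix_imp_sublist)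

text \<open>A factor containing \<open>n\<close> has \<open>n\<close> as its maximum; a factor
  without \<open>n\<close> lies on one side of it, because factors are contiguous. This is the
  recursion on the tree with root \<open>n\<close>.\<close>

lemma tree_mono_split:
  assumes "\<forall>x\<in>set \<alpha> \<union> set \<beta>. x < n"
  shows "tree_mono f (\<alpha> @ n # \<beta>) \<longleftrightarrow>
     tree_mono f \<alpha> \<and> tree_mono f \<beta> \<and> (\<forall>x\<in>set \<alpha> \<union> set \<beta>. f x < f n)"
proof (intro iffI conjI ballI)
  assume *: "tree_mono f (\<alpha> @ n # \<beta>)"
  show "tree_mono f \<alpha>"
    using * by (rule tree_mono_sublist) simp
  show "tree_mono f \<beta>"
    using * by (rule tree_mono_sublist) (metis append.assoc append_Cons append_Nil sublist_appendI append_Nil2)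
  fix x assume "x \<in> set \<alpha> \<union> set \<beta>"
  thus "f x < f n"
    using assms by (intro tree_monoD[OF *, of "\<alpha> @ n # \<beta>"]) (auto simp: less_imp_le)
next
  assume *: "tree_mono f \<alpha> \<and> tree_mono f \<beta> \<and> (\<forall>x\<in>set \<alpha> \<union> set \<beta>. f x < f n)"
  show "tree_mono f (\<alpha> @ n # \<beta>)"
    unfolding tree_mono_def
  proof (intro allI impI ballI)
    fix u a b
    assume u: "sublist u (\<alpha> @ n # \<beta>)" and a: "a \<in> set u" and b: "b \<in> set u" and "a < b"
      and max: "\<forall>c\<in>set u. c \<le> b"
    have sub: "set u \<subseteq> set \<alpha> \<union> set \<beta> \<union> {n}"
      using set_mono_sublist[OF u] by auto
    show "f a < f b"
    proof (cases "n \<in> set u")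
      case True
      hence "n \<le> b" using max by blast
      hence "b = n" using sub b assms by (metis UnE leD singletonD subsetD)
      thus ?thesis using sub a \<open>a < b\<close> * by auto
    next
      case False
      thus ?thesis
        using sublist_around[OF u False] * a b \<open>a < b\<close> max by (auto simp: tree_mono_def)
    qed
  qed
qed

text \<open>Stack sorting keeps every ancestor pair: in S(\<alpha>) S(\<beta>) n the root is still
  the maximum of the whole, and the two sorted sides are still factors. So the condition pulls back
  from the output to the input.\<close>

lemma tree_mono_stack_sort:
  assumes "distinct xs" "tree_mono f (stack_sort xs)"
  shows "tree_mono f xs"
  using assms
proof (induction rule: distinct_max_induct)
  case (split \<alpha> n \<beta>)
  have *: "tree_mono f ((stack_sort \<alpha> @ stack_sort \<beta>) @ n # [])"
    using split.prems split.hyps by (simp add: stack_sort_append)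
  have "\<forall>x\<in>set (stack_sort \<alpha> @ stack_sort \<beta>) \<union> set []. x < n"
    using split.hyps by simp
  note ** = *[unfolded tree_mono_split[OF this]]
  have "tree_mono f (stack_sort \<alpha>)" "tree_mono f (stack_sort \<beta>)"
    using ** tree_mono_sublist by auto
  thus ?case
    using ** split by (subst tree_mono_split) auto
qed (simp add: tree_mono_def)

text \<open>The image of the root is the maximum of the mapped sequence and stands at the same
  position, so both recursions split alike.\<close>

lemma stack_sort_map:
  assumes "distinct xs" "tree_mono f xs"
  shows "stack_sort (map f xs) = map f (stack_sort xs)"
  using assms
proof (induction rule: distinct_max_induct)
  case (split \<alpha> n \<beta>)
  note * = split.prems[unfolded tree_mono_split[OF split.hyps(2)]]
  hence "\<forall>x\<in>set (map f \<alpha>) \<union> set (map f \<beta>). x < f n" by auto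
  thus ?case
    using split * by (simp add: stack_sort_append)
qed (simp add: stack_sort_Nil)

text \<open>The assumption sits at the last sequence \<open>A xs\<close>. Pulled back one operator
  at a time, it reaches every intermediate sequence and lets the operator applied there commute with
  \<open>map f\<close>.\<close>

lemma compositions_map:
  assumes "A \<in> compositions" "distinct xs" "tree_mono f (A xs)"
  shows "tree_mono f xs \<and> A (map f xs) = map f (A xs)"
  using assms
proof induction
  case (S A)
  have "distinct (A xs)"
    using S by (simp add: compositions_set_distinct)
  moreover from this have "tree_mono f (A xs)"
    using S.prems by (simp add: tree_mono_stack_sort)
  ultimately show ?case
    using S by (simp add: stack_sort_map)
qed (auto simp: rev_map)

text \<open>On each factor \<open>f\<close> sends the maximum to the maximum, so comparisons with
  the maximum can be read backwards. This serves the surjectivity of \<open>Phi\<close>.\<close>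

lemma tree_mono_inverse:
  assumes "tree_mono f xs" "\<And>x. x \<in> set xs \<Longrightarrow> g (f x) = x"
  shows "tree_mono g (map f xs)"
  unfolding tree_mono_def
proof (intro allI impI ballI)
  fix u a b
  assume u: "sublist u (map f xs)" and "a \<in> set u" and "b \<in> set u" and "a < b"
    and max: "\<forall>c\<in>set u. c \<le> b"
  obtain v where v: "sublist v xs" "u = map f v"
    using sublist_map_rightE[OF u] by blast
  obtain a' b' where a': "a' \<in> set v" "a = f a'" and b': "b' \<in> set v" "b = f b'"
    using \<open>a \<in> set u\<close> \<open>b \<in> set u\<close> v by auto
  have "b' = Max (set v)"
  proof (rule ccontr)
    assume "b' \<noteq> Max (set v)"
    moreover have "b' \<le> Max (set v)" "Max (set v) \<in> set v"
      using b' by (auto intro: Max_in)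
    ultimately have "f b' < f (Max (set v))"
      using tree_monoD[OF assms(1) v(1) b'(1), of "Max (set v)"] by auto
    moreover have "f (Max (set v)) \<le> f b'"
      using max v b' \<open>Max (set v) \<in> set v\<close> by auto
    ultimately show False by simp
  qed
  hence "a' \<le> b'" using a' by simp
  hence "a' < b'" using \<open>a < b\<close> a' b' by (cases "a' = b'") auto
  moreover have "g a = a'" "g b = b'"
    using a' b' assms(2) set_mono_sublist[OF v(1)] by auto
  ultimately show "g a < g b" by simp
qed

section \<open>The relation between \<open>231\<close>-avoiders and \<open>132\<close>-avoiders given by \<open>P\<close>\<close>

abbreviation shift :: "nat \<Rightarrow> nat list \<Rightarrow> nat list" where
  "shift k \<equiv> map (\<lambda>x. x + k)"

lemma stack_sort_shift: "distinct xs \<Longrightarrow> stack_sort (shift k xs) = shift k (stack_sort xs)"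
  by (intro stack_sort_map tree_mono_strict_mono) (auto simp: strict_mono_def)

lemma shift_upt: "shift k [i..<j] = [i + k..<j + k]"
  by (intro nth_equalityI) auto

section \<open>Stack-sortable permutations and the graph of \<open>P\<close>\<close>

text \<open>The equation includes that \<open>xs\<close> is a permutation of
  \<open>{1..length xs}\<close>, as sorting keeps the multiset of entries.\<close>

definition stack_sortable :: "nat list \<Rightarrow> bool" where
  "stack_sortable xs \<longleftrightarrow> stack_sort xs = [1..<Suc (length xs)]"

lemma stack_sortable_distinct: "stack_sortable xs \<Longrightarrow> distinct xs"
  unfolding stack_sortable_def by (metis distinct_stack_sort distinct_upt)

lemma stack_sortable_set: "stack_sortable xs \<Longrightarrow> set xs = {1..length xs}"
  unfolding stack_sortable_def by (metis set_stack_sort set_upt atLeastLessThanSuc_atLeastAtMost)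

lemma upt_split_three: "[1..<Suc (a + Suc b)] = [1..<Suc a] @ [Suc a..<Suc (a + b)] @ [Suc (a + b)]"
  using upt_add_eq_append[of 1 "Suc a" "Suc b"] by simp

text \<open>By Knuth's theorem the stack-sortable permutations are those in \<open>Av(231)\<close>; the argument only
  needs the decomposition \<open>\<alpha> \<oplus> (1 \<ominus> \<beta>)\<close>, here obtained directly from sortability.\<close>

lemma stack_sortable_split:
  assumes "stack_sortable \<pi>" "\<pi> \<noteq> []"
  obtains \<alpha> \<beta> where "stack_sortable \<alpha>" "stack_sortable \<beta>"
    "\<pi> = \<alpha> @ Suc (length \<alpha> + length \<beta>) # shift (length \<alpha>) \<beta>"
proof -
  define \<alpha> n \<gamma> where "\<alpha> = before_max \<pi>" and "n = Max (set \<pi>)" and "\<gamma> = after_max \<pi>"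
  have \<pi>: "\<pi> = \<alpha> @ n # \<gamma>"
    using split_at_max[OF assms(2)] by (simp add: \<alpha>_def n_def \<gamma>_def)
  have "stack_sort \<pi> = stack_sort \<alpha> @ stack_sort \<gamma> @ [n]"
    using assms(2) by (subst stack_sort.simps) (simp add: \<alpha>_def n_def \<gamma>_def)
  moreover have "[1..<Suc (length \<pi>)] =
      [1..<Suc (length \<alpha>)] @ [Suc (length \<alpha>)..<Suc (length \<alpha> + length \<gamma>)] @ [Suc (length \<alpha> + length \<gamma>)]"
    using upt_split_three[of "length \<alpha>" "length \<gamma>"] by (simp add: \<pi> del: upt_Suc)
  \<comment> \<open>Corresponding blocks of the two factorisations have equal lengths, so they
    coincide: sortability puts the values of \<alpha> below those of \<gamma>.\<close>
  ultimately have eqs: "stack_sort \<alpha> = [1..<Suc (length \<alpha>)]"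
      "stack_sort \<gamma> = [Suc (length \<alpha>)..<Suc (length \<alpha> + length \<gamma>)]" "n = Suc (length \<alpha> + length \<gamma>)"
    using assms(1) unfolding stack_sortable_def by (auto simp del: upt_Suc)
  define \<beta> where "\<beta> = map (\<lambda>x. x - length \<alpha>) \<gamma>"
  have "set \<gamma> = {Suc (length \<alpha>)..<Suc (length \<alpha> + length \<gamma>)}"
    using eqs(2) by (metis set_stack_sort set_upt)
  hence \<gamma>: "\<gamma> = shift (length \<alpha>) \<beta>"
    unfolding \<beta>_def map_map by (intro map_idI[symmetric]) auto
  have len: "length \<beta> = length \<gamma>" by (simp add: \<beta>_def)
  have "distinct \<gamma>"
    using stack_sortable_distinct[OF assms(1)] by (simp add: \<pi>)
  hence "distinct \<beta>" unfolding \<gamma> by (simp add: distinct_map)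
  hence "shift (length \<alpha>) (stack_sort \<beta>) = shift (length \<alpha>) [1..<Suc (length \<beta>)]"
    using eqs(2) unfolding \<gamma> by (simp add: stack_sort_shift shift_upt add.commute del: upt_Suc)
  moreover have "inj (\<lambda>x::nat. x + length \<alpha>)" by simp
  ultimately have "stack_sortable \<beta>"
    unfolding stack_sortable_def by (metis inj_map_eq_map)
  moreover have "stack_sortable \<alpha>" using eqs(1) by (simp add: stack_sortable_def)
  ultimately show ?thesis using that \<pi> \<gamma> eqs(3) len by metis
qed

text \<open>The graph of \<open>P\<close>. As \<open>\<sigma> \<in> Av(132)\<close> iff \<open>rev \<sigma> \<in> Av(231)\<close>, its range is the set of all \<open>\<sigma>\<close> with
  \<open>rev \<sigma>\<close> stack-sortable.\<close>

inductive P_related :: "nat list \<Rightarrow> nat list \<Rightarrow> bool" where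
  Nil: "P_related [] []"
| step: "P_related \<alpha> \<alpha>' \<Longrightarrow> P_related \<beta> \<beta>' \<Longrightarrow>
     P_related (\<alpha> @ Suc (length \<alpha> + length \<beta>) # shift (length \<alpha>) \<beta>)
       (shift (length \<beta>) \<alpha>' @ Suc (length \<alpha> + length \<beta>) # \<beta>')"

lemma stack_sortable_join:
  assumes "stack_sortable \<alpha>" "stack_sortable \<beta>"
  shows "stack_sortable (\<alpha> @ Suc (length \<alpha> + length \<beta>) # shift (length \<alpha>) \<beta>)"
proof -
  have *: "\<forall>x\<in>set \<alpha> \<union> set (shift (length \<alpha>) \<beta>). x < Suc (length \<alpha> + length \<beta>)"
    using assms[THEN stack_sortable_set] by auto
  show ?thesis
    using assms stack_sortable_distinct[OF assms(2)] upt_split_three[of "length \<alpha>" "length \<beta>"]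
    unfolding stack_sortable_def
    by (simp add: stack_sort_append[OF *] stack_sort_shift shift_upt add.commute del: upt_Suc)
qed

lemma P_related_length: "P_related \<pi> \<sigma> \<Longrightarrow> length \<sigma> = length \<pi>"
  by (induction rule: P_related.induct) auto

text \<open>Reversing the image gives the reverse of \<open>\<beta>'\<close>, the maximum, then the
  shifted reverse of \<open>\<alpha>'\<close>: the same decomposition with the roles of the two
  blocks exchanged.\<close>

lemma P_related_stack_sortable:
  "P_related \<pi> \<sigma> \<Longrightarrow> stack_sortable \<pi> \<and> stack_sortable (rev \<sigma>)"
proof (induction rule: P_related.induct)
  case Nil
  show ?case by (simp add: stack_sortable_def stack_sort_Nil)
next
  case (step \<alpha> \<alpha>' \<beta> \<beta>')
  have "length \<alpha>' = length \<alpha>" "length \<beta>' = length \<beta>"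
    using step.hyps by (auto dest: P_related_length)
  thus ?case
    using step.IH stack_sortable_join[of \<alpha> \<beta>] stack_sortable_join[of "rev \<beta>'" "rev \<alpha>'"]
    by (simp add: rev_map add.commute)
qed

lemma P_related_ex_right:
  assumes "stack_sortable \<pi>"
  shows "\<exists>\<sigma>. P_related \<pi> \<sigma>"
  using assms
proof (induction \<pi> rule: length_induct)
  case (1 \<pi>)
  show ?case
  proof (cases "\<pi> = []")
    case False
    with "1.prems" obtain \<alpha> \<beta> where s: "stack_sortable \<alpha>" "stack_sortable \<beta>" and
      \<pi>: "\<pi> = \<alpha> @ Suc (length \<alpha> + length \<beta>) # shift (length \<alpha>) \<beta>"
      by (rule stack_sortable_split)
    have "\<exists>\<sigma>. P_related \<alpha> \<sigma>" "\<exists>\<sigma>. P_related \<beta> \<sigma>"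
      using "1.IH" s by (simp_all add: \<pi>)
    thus ?thesis unfolding \<pi> by (blast intro: P_related.step)
  qed (auto intro: P_related.Nil)
qed

text \<open>Decomposing the reverse of \<sigma>, the block before the maximum yields the \<beta>
  part of the preimage and the block after it the \<alpha> part.\<close>

lemma P_related_ex_left:
  assumes "stack_sortable (rev \<sigma>)"
  shows "\<exists>\<pi>. P_related \<pi> \<sigma>"
  using assms
proof (induction \<sigma> rule: length_induct)
  case (1 \<sigma>)
  show ?case
  proof (cases "\<sigma> = []")
    case False
    with "1.prems" obtain \<beta> \<alpha> where s: "stack_sortable \<beta>" "stack_sortable \<alpha>" and
      \<sigma>: "rev \<sigma> = \<beta> @ Suc (length \<beta> + length \<alpha>) # shift (length \<beta>) \<alpha>"
      by (metis stack_sortable_split rev_is_Nil_conv)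
    have \<sigma>': "\<sigma> = shift (length \<beta>) (rev \<alpha>) @ Suc (length \<alpha> + length \<beta>) # rev \<beta>"
      using arg_cong[OF \<sigma>, of rev] by (simp add: rev_map add.commute)
    have "\<exists>\<pi>. P_related \<pi> (rev \<alpha>)" "\<exists>\<pi>. P_related \<pi> (rev \<beta>)"
      using "1.IH" s by (simp_all add: \<sigma>')
    then obtain \<pi>1 \<pi>2 where \<pi>: "P_related \<pi>1 (rev \<alpha>)" "P_related \<pi>2 (rev \<beta>)" by blast
    from P_related.step[OF this] \<pi>[THEN P_related_length] show ?thesis
      by (auto simp: \<sigma>')
  qed (auto intro: P_related.Nil)
qed

lemma P_related_less:
  assumes "P_related \<alpha> \<alpha>'" "P_related \<beta> \<beta>'"
  shows "\<forall>x\<in>set \<alpha> \<union> set (shift (length \<alpha>) \<beta>). x < Suc (length \<alpha> + length \<beta>)"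
    and "\<forall>x\<in>set (shift (length \<beta>) \<alpha>') \<union> set \<beta>'. x < Suc (length \<alpha> + length \<beta>)"
proof -
  have "set \<alpha> = {1..length \<alpha>}" "set \<beta> = {1..length \<beta>}"
       "set \<alpha>' = {1..length \<alpha>}" "set \<beta>' = {1..length \<beta>}"
    using assms[THEN P_related_stack_sortable] assms[THEN P_related_length]
    by (metis stack_sortable_set set_rev length_rev)+
  thus "\<forall>x\<in>set \<alpha> \<union> set (shift (length \<alpha>) \<beta>). x < Suc (length \<alpha> + length \<beta>)"
    "\<forall>x\<in>set (shift (length \<beta>) \<alpha>') \<union> set \<beta>'. x < Suc (length \<alpha> + length \<beta>)"
    by auto
qed

text \<open>Ties the inductive graph to the recursive function, so that \<open>lam\<close> can be
  studied through \<open>P_related\<close>.\<close>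

lemma P_related_Pmap: "P_related \<pi> \<sigma> \<Longrightarrow> Pmap \<pi> = \<sigma>"
proof (induction rule: P_related.induct)
  case (step \<alpha> \<alpha>' \<beta> \<beta>')
  note less = P_related_less(1)[OF step.hyps]
  have "length \<alpha>' = length \<alpha>" "length \<beta>' = length \<beta>"
    using step.hyps by (auto dest: P_related_length)
  thus ?case
    using step.IH
    by (subst Pmap.simps)
      (simp add: before_max_append[OF less] after_max_append[OF less] osum_def ominus_def comp_def)
qed (rule Pmap_Nil)

text \<open>The maximum of \<sigma> separates the two image blocks; the length of the right block is
  the shift that has to be undone in the left one.\<close>

lemma P_related_inj:
  assumes "P_related \<pi> \<sigma>" "P_related \<pi>' \<sigma>"
  shows "\<pi> = \<pi>'"
  using assms
proof (induction arbitrary: \<pi>' rule: P_related.induct)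
  case Nil
  thus ?case by (auto dest: P_related_length)
next
  case (step \<alpha> \<alpha>' \<beta> \<beta>')
  from step.prems show ?case
  proof (cases rule: P_related.cases)
    case Nil
    thus ?thesis by simp
  next
    case (step \<gamma> \<gamma>' \<delta> \<delta>')
    note less = P_related_less(2)[OF \<open>P_related \<alpha> \<alpha>'\<close> \<open>P_related \<beta> \<beta>'\<close>]
      and less' = P_related_less(2)[OF \<open>P_related \<gamma> \<gamma>'\<close> \<open>P_related \<delta> \<delta>'\<close>]
    have \<beta>': "\<beta>' = \<delta>'"
      using local.step(2) after_max_append[OF less] after_max_append[OF less'] by metis
    hence len: "length \<beta> = length \<delta>"
      using \<open>P_related \<beta> \<beta>'\<close> \<open>P_related \<delta> \<delta>'\<close> by (metis P_related_length)
    have "shift (length \<beta>) \<alpha>' = shift (length \<delta>) \<gamma>'"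
      using local.step(2) before_max_append[OF less] before_max_append[OF less'] by metis
    moreover have "inj (\<lambda>x::nat. x + length \<delta>)" by simp
    ultimately have "\<alpha>' = \<gamma>'"
      unfolding len by (metis inj_map_eq_map)
    thus ?thesis
      using step.IH local.step \<beta>' by metis
  qed
qed

lemma tree_mono_shift: "tree_mono (\<lambda>x. f (x + k)) xs \<Longrightarrow> tree_mono f (shift k xs)"
  unfolding tree_mono_def
proof (intro allI impI ballI)
  fix u a b
  assume *: "\<forall>u. sublist u xs \<longrightarrow> (\<forall>a\<in>set u. \<forall>b\<in>set u. a < b \<longrightarrow> (\<forall>c\<in>set u. c \<le> b) \<longrightarrow> f (a + k) < f (b + k))"
    and u: "sublist u (shift k xs)" "a \<in> set u" "b \<in> set u" "a < b" "\<forall>c\<in>set u. c \<le> b"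
  obtain v where "sublist v xs" "u = shift k v"
    using sublist_map_rightE[OF u(1)] by blast
  thus "f a < f b" using * u by auto
qed

text \<open>\<open>P\<close> keeps the root value and maps each subtree to the corresponding one up
  to a constant shift of values. The induction generalises over \<open>f\<close> to absorb these
  shifts.\<close>

lemma P_related_tree_mono:
  assumes "P_related \<pi> \<sigma>" "\<sigma> = map f \<pi>"
  shows "tree_mono f \<pi>"
  using assms
proof (induction arbitrary: f rule: P_related.induct)
  case Nil
  show ?case by (simp add: tree_mono_def)
next
  case (step \<alpha> \<alpha>' \<beta> \<beta>')
  have "length \<alpha>' = length \<alpha>" using step.hyps by (auto dest: P_related_length)
  hence eqs: "map f \<alpha> = shift (length \<beta>) \<alpha>'" "f (Suc (length \<alpha> + length \<beta>)) = Suc (length \<alpha> + length \<beta>)"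
    "map f (shift (length \<alpha>) \<beta>) = \<beta>'"
    using step.prems by auto
  \<comment> \<open>The induction hypothesis needs a map producing \<open>\<alpha>'\<close> itself,
    hence the subtraction. Truncation does no harm: a strict inequality of truncated differences
    implies one of the values.\<close>
  have "\<alpha>' = map (\<lambda>x. f x - length \<beta>) \<alpha>"
    using arg_cong[OF eqs(1), of "map (\<lambda>x. x - length \<beta>)"] by (simp add: comp_def)
  hence *: "tree_mono (\<lambda>x. f x - length \<beta>) \<alpha>" by (rule step.IH)
  have "tree_mono f \<alpha>"
    unfolding tree_mono_def
  proof (intro allI impI ballI)
    fix u a b
    assume "sublist u \<alpha>" "a \<in> set u" "b \<in> set u" "a < b" "\<forall>c\<in>set u. c \<le> b"
    hence "f a - length \<beta> < f b - length \<beta>"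
      using * unfolding tree_mono_def by blast
    thus "f a < f b" by simp
  qed
  moreover have "\<beta>' = map (\<lambda>x. f (x + length \<alpha>)) \<beta>"
    using eqs(3) by (simp add: comp_def)
  hence "tree_mono f (shift (length \<alpha>) \<beta>)" by (intro tree_mono_shift step.IH)
  moreover have "\<forall>x\<in>set \<alpha> \<union> set (shift (length \<alpha>) \<beta>). f x < f (Suc (length \<alpha> + length \<beta>))"
  proof
    fix x assume "x \<in> set \<alpha> \<union> set (shift (length \<alpha>) \<beta>)"
    hence "f x \<in> set (map f \<alpha>) \<union> set (map f (shift (length \<alpha>) \<beta>))" by auto
    thus "f x < f (Suc (length \<alpha> + length \<beta>))"
      unfolding eqs using P_related_less(2)[OF step.hyps] by blast
  qed
  ultimately show ?case
    by (subst tree_mono_split[OF P_related_less(1)[OF step.hyps]]) blast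
qed

section \<open>The permutation \<open>lam \<pi>\<close>\<close>

text \<open>Existence is by table lookup along the two lists. Uniqueness holds since the lists
  determine the map on \<open>B\<close> and \<open>permutes\<close> fixes the rest.\<close>

lemma ex1_permutes_map:
  assumes "distinct xs" "distinct ys" "set xs = B" "set ys = B"
  shows "\<exists>!l. l permutes B \<and> ys = map l xs"
proof (rule ex_ex1I)
  have len: "length xs = length ys"
    using assms by (metis distinct_card)
  define l where "l = (\<lambda>x. if x \<in> B then the (map_of (zip xs ys) x) else x)"
  have nth: "l (xs ! i) = ys ! i" if "i < length xs" for i
    using that assms len by (auto simp: l_def map_of_zip_nth)
  hence map: "ys = map l xs"
    using len by (intro nth_equalityI) auto
  hence "bij_betw l B B"
    using assms by (auto simp: bij_betw_def distinct_map)
  hence "l permutes B"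
    by (rule bij_imp_permutes) (simp add: l_def)
  with map show "\<exists>l. l permutes B \<and> ys = map l xs" by blast
next
  fix l l'
  assume l: "l permutes B \<and> ys = map l xs" and l': "l' permutes B \<and> ys = map l' xs"
  show "l = l'"
  proof
    fix x
    have "l x = l' x" if "x \<in> B"
      using that l l' assms(3) by (metis map_eq_conv)
    thus "l x = l' x"
      using l l' by (metis permutes_not_in)
  qed
qed

text \<open>Discharges the definite description in \<open>lam\<close>.\<close>

lemma lam_eqI:
  assumes "P_related \<pi> \<sigma>"
  shows "lam \<pi> permutes {1..length \<pi>} \<and> \<sigma> = map (lam \<pi>) \<pi>"
proof -
  note s = P_related_stack_sortable[OF assms]
  have "\<exists>!l. l permutes {1..length \<pi>} \<and> Pmap \<pi> = map l \<pi>"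
    unfolding P_related_Pmap[OF assms]
    using s[THEN conjunct1, THEN stack_sortable_distinct] s[THEN conjunct2, THEN stack_sortable_distinct]
      s[THEN conjunct1, THEN stack_sortable_set] s[THEN conjunct2, THEN stack_sortable_set]
      P_related_length[OF assms]
    by (intro ex1_permutes_map) auto
  from theI'[OF this] show ?thesis
    by (simp add: lam_def P_related_Pmap[OF assms])
qed

section \<open>Invariance of the statistics\<close>

text \<open>If another entry were the maximum of the factor, its image would exceed
  \<open>f b\<close>. Taking prefixes, suffixes and adjacent pairs as \<open>w\<close> gives both
  kinds of maxima and the up-down word. If \<open>b\<close> lies in \<open>U\<close>, both sides are
  false.\<close>

lemma tree_mono_strict_max_iff:
  assumes "tree_mono f xs" "sublist w xs" "set w = insert b U"
  shows "(\<forall>a\<in>U. f a < f b) \<longleftrightarrow> (\<forall>a\<in>U. a < b)"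
proof (intro iffI ballI)
  fix a assume "\<forall>a\<in>U. a < b" "a \<in> U"
  thus "f a < f b"
    using assms(3) by (intro tree_monoD[OF assms(1,2)]) (auto simp: less_imp_le)
next
  assume *: "\<forall>a\<in>U. f a < f b"
  have "Max (set w) = b"
  proof (rule ccontr)
    assume neq: "Max (set w) \<noteq> b"
    have in_w: "Max (set w) \<in> set w"
      using assms(3) by (metis List.finite_set Max_in insert_not_empty)
    hence "Max (set w) \<in> U" using neq assms(3) by auto
    moreover have max: "c \<le> Max (set w)" if "c \<in> set w" for c
      using that by simp
    have "b < Max (set w)"
      using neq max[of b] assms(3) by simp
    hence "f b < f (Max (set w))"
      using in_w assms(3) max by (intro tree_monoD[OF assms(1,2)]) auto
    ultimately show False using * by fastforce
  qed
  hence max: "a \<le> b" if "a \<in> U" for a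
    using that assms(3) by (metis List.finite_set Max_ge insertI2)
  fix a assume "a \<in> U"
  with max[OF this] * show "a < b" by (cases "a = b") auto
qed

lemma lr_max_positions_map:
  assumes "tree_mono f xs"
  shows "lr_max_positions (map f xs) = lr_max_positions xs"
proof -
  have "(\<forall>j<i. f (xs ! j) < f (xs ! i)) \<longleftrightarrow> (\<forall>j<i. xs ! j < xs ! i)" if "i < length xs" for i
  proof -
    have "set (take (Suc i) xs) = insert (xs ! i) ((!) xs ` {..<i})"
      using that nth_image[of i xs] by (simp add: take_Suc_conv_app_nth lessThan_atLeast0)
    from tree_mono_strict_max_iff[OF assms sublist_take this] show ?thesis by auto
  qed
  thus ?thesis unfolding lr_max_positions_def by (intro Collect_cong conj_cong) auto
qed

lemma rl_max_positions_map:
  assumes "tree_mono f xs"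
  shows "rl_max_positions (map f xs) = rl_max_positions xs"
proof -
  have "(\<forall>j. i < j \<and> j < length xs \<longrightarrow> f (xs ! j) < f (xs ! i)) \<longleftrightarrow>
        (\<forall>j. i < j \<and> j < length xs \<longrightarrow> xs ! j < xs ! i)" if "i < length xs" for i
  proof -
    have "set (drop (Suc i) xs) = (!) xs ` {i<..<length xs}"
    proof (intro equalityI subsetI)
      fix x assume "x \<in> set (drop (Suc i) xs)"
      then obtain j where "j < length xs - Suc i" "x = xs ! (Suc i + j)"
        by (auto simp: in_set_conv_nth)
      thus "x \<in> (!) xs ` {i<..<length xs}" by (intro image_eqI[of _ _ "Suc i + j"]) auto
    next
      fix x assume "x \<in> (!) xs ` {i<..<length xs}"
      then obtain j where "i < j" "j < length xs" "x = xs ! j" by auto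
      thus "x \<in> set (drop (Suc i) xs)"
        by (auto simp: in_set_conv_nth intro!: exI[of _ "j - Suc i"])
    qed
    hence "set (drop i xs) = insert (xs ! i) ((!) xs ` {i<..<length xs})"
      using that by (metis Cons_nth_drop_Suc list.simps(15))
    from tree_mono_strict_max_iff[OF assms sublist_drop this] show ?thesis by auto
  qed
  thus ?thesis unfolding rl_max_positions_def by (intro Collect_cong) auto
qed

lemma updown_word_map:
  assumes "tree_mono f xs"
  shows "updown_word (map f xs) = updown_word xs"
proof -
  have "f (xs ! i) < f (xs ! Suc i) \<longleftrightarrow> xs ! i < xs ! Suc i" if "Suc i < length xs" for i
  proof -
    have "drop i xs = xs ! i # xs ! Suc i # drop (Suc (Suc i)) xs"
      using that by (simp add: Cons_nth_drop_Suc)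
    hence "set (take 2 (drop i xs)) = insert (xs ! Suc i) {xs ! i}" by auto
    moreover have "sublist (take 2 (drop i xs)) xs"
      by (meson sublist_order.order.trans sublist_drop sublist_take)
    ultimately show ?thesis
      using tree_mono_strict_max_iff[OF assms] by blast
  qed
  thus ?thesis by (auto simp: updown_word_def)
qed

section \<open>Top entries under stack sorting\<close>

lemma perms_iff: "\<theta> \<in> perms \<longleftrightarrow> distinct \<theta> \<and> set \<theta> = {1..length \<theta>}"
  by (auto simp: perms_def permutations_of_set_def)

lemma map_in_perms:
  assumes "\<theta> \<in> perms" "f permutes {1..length \<theta>}"
  shows "map f \<theta> \<in> perms"
  using assms by (auto simp: perms_iff distinct_map permutes_image permutes_inj_on)

text \<open>If the top entries of \<open>xs\<close> appear in decreasing order, each of them follows the larger ones, so it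
  lies in the right subtree and is postponed to the end by stack sorting.\<close>

lemma stack_sort_suffix:
  assumes "distinct xs" "subseq ys xs" "sorted_wrt (>) ys"
    and "\<And>x y. x \<in> set xs - set ys \<Longrightarrow> y \<in> set ys \<Longrightarrow> x < y"
  shows "suffix (rev ys) (stack_sort xs)"
  using assms
proof (induction ys arbitrary: xs)
  case (Cons y ys)
  obtain \<alpha> \<beta> where xs: "xs = \<alpha> @ y # \<beta>" and sub: "subseq ys \<beta>"
    using list_emb_ConsD[OF Cons.prems(2)] by blast
  have less: "\<forall>x\<in>set \<alpha> \<union> set \<beta>. x < y"
  proof
    fix x assume x: "x \<in> set \<alpha> \<union> set \<beta>"
    show "x < y"
      using x Cons.prems(1,3) Cons.prems(4)[of x y] by (cases "x \<in> set ys") (auto simp: xs)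
  qed
  have "suffix (rev ys) (stack_sort \<beta>)"
  proof (rule Cons.IH)
    fix x z assume "x \<in> set \<beta> - set ys" "z \<in> set ys"
    thus "x < z"
      using Cons.prems(1) by (intro Cons.prems(4)) (auto simp: xs)
  qed (use Cons.prems sub xs in auto)
  thus ?case
    by (auto simp: xs stack_sort_append[OF less] suffix_def)
qed simp

text \<open>Only the maximum \<open>n\<close> changes sides in the recursion, and an increasing
  subsequence that uses \<open>n\<close> ends there, so moving \<open>n\<close> to the end does not
  disturb it.\<close>

lemma stack_sort_increasing_subseq:
  assumes "distinct xs" "subseq ys xs" "sorted_wrt (<) ys"
  shows "subseq ys (stack_sort xs)"
  using assms
proof (induction arbitrary: ys rule: distinct_max_induct)
  case (split \<alpha> n \<beta>)
  from split.prems(1) obtain y1 y2 where ys: "ys = y1 @ y2" and sub: "subseq y1 \<alpha>" "subseq y2 (n # \<beta>)"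
    by (rule subseq_appendE)
  have 1: "subseq y1 (stack_sort \<alpha>)"
    using split.IH(1) sub(1) split.prems(2) by (simp add: ys sorted_wrt_append)
  show ?case
  proof (cases "\<exists>z. y2 = n # z")
    case True
    then obtain z where z: "y2 = n # z" by blast
    have "z = []"
    proof (cases z)
      case (Cons x z')
      have "x \<in> set \<beta>"
        using sub(2) unfolding z Cons by (auto dest: list_emb_set)
      moreover have "n < x"
        using split.prems(2) by (simp add: ys z Cons sorted_wrt_append)
      ultimately show ?thesis using split.hyps(2) by (meson UnI2 order.asym)
    qed simp
    hence "subseq ys (stack_sort \<alpha> @ [n])"
      using 1 by (simp add: ys z list_emb_append_mono)
    also have "subseq (stack_sort \<alpha> @ [n]) (stack_sort \<alpha> @ stack_sort \<beta> @ [n])"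
      by (intro list_emb_append_mono) auto
    finally show ?thesis by (simp add: stack_sort_append[OF split.hyps(2)])
  next
    case False
    hence "subseq y2 \<beta>"
      using sub(2) by (cases y2) (auto simp: subseq_Cons2_neq)
    hence "subseq y2 (stack_sort \<beta>)"
      using split.IH(2) split.prems(2) by (simp add: ys sorted_wrt_append)
    thus ?thesis
      using 1 unfolding ys stack_sort_append[OF split.hyps(2)] append_assoc[symmetric]
      by (intro subseq_rev_drop_many list_emb_append_mono)
  qed
qed (simp add: stack_sort_Nil)

lemma funpow_stack_sort_simps [simp]:
  "set ((stack_sort ^^ k) xs) = set xs" "distinct ((stack_sort ^^ k) xs) = distinct xs"
  by (induction k) auto

lemma funpow_stack_sort_increasing_subseq:
  assumes "distinct xs" "subseq ys xs" "sorted_wrt (<) ys"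
  shows "subseq ys ((stack_sort ^^ k) xs)"
  using assms by (induction k) (auto simp: stack_sort_increasing_subseq)

text \<open>One entry more than the \<open>k\<close> top ones is fixed: \<open>n - k\<close> is the maximum of the part of \<open>stack_sort \<theta>\<close> that
  precedes the final run \<open>n - k + 1, \<dots>, n\<close>. Without it, \<open>zeil\<close> could increase.\<close>

lemma top_entries_fixed:
  assumes "distinct \<theta>" "set \<theta> = {1..n}" "k \<le> n" "subseq (rev [Suc n - k..<Suc n]) \<theta>"
    and f: "f permutes {1..n}" and mono: "tree_mono f (stack_sort \<theta>)" and "n - k \<le> b"
  shows "f b = b"
proof (cases "b \<in> {1..n}")
  case True
  have "suffix (rev (rev [Suc n - k..<Suc n])) (stack_sort \<theta>)"
    by (rule stack_sort_suffix) (use assms in \<open>auto simp: sorted_wrt_rev simp del: upt_Suc\<close>)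
  then obtain p where p: "stack_sort \<theta> = p @ [Suc n - k..<Suc n]"
    by (auto simp: suffix_def simp del: upt_Suc)
  have set_eq: "set p \<union> {Suc n - k..<Suc n} = {1..n}"
    using assms(2) p by (metis set_append set_stack_sort set_upt)
  moreover have "set p \<inter> {Suc n - k..<Suc n} = {}"
    using assms(1) p by (metis distinct_append distinct_stack_sort set_upt)
  ultimately have p_le: "x \<le> n - k" if "x \<in> set p" for x
  proof -
    have "x \<in> {1..n}" "x \<notin> {Suc n - k..<Suc n}"
      using that \<open>set p \<inter> _ = {}\<close> set_eq by blast+
    thus ?thesis by auto
  qed
  \<comment> \<open>The factor consists of \<open>p\<close> and the final run up to
    \<open>c\<close>, so its maximum is \<open>c\<close>. For \<open>c = n - k\<close> the run is
    empty and \<open>c\<close> belongs to \<open>p\<close>.\<close>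
  have less: "f a < f c" if "n - k \<le> c" "c \<in> {1..n}" "a \<in> {1..n}" "a < c" for a c
  proof -
    let ?u = "p @ [Suc n - k..<Suc c]"
    have "[Suc n - k..<Suc n] = [Suc n - k..<Suc c] @ [Suc c..<Suc n]"
    proof -
      have "Suc n - k \<le> Suc c" "Suc n = Suc c + (n - c)" using that by auto
      thus ?thesis by (metis upt_add_eq_append)
    qed
    hence "sublist ?u (stack_sort \<theta>)"
      unfolding p by (metis append_assoc prefixI prefix_imp_sublist)
    moreover have "a \<in> set ?u" "c \<in> set ?u"
      using that set_eq by (auto simp del: upt_Suc)
    moreover have "x \<le> c" if "x \<in> set ?u" for x
      using that p_le \<open>n - k \<le> c\<close> by (fastforce simp del: upt_Suc)
    ultimately show ?thesis
      using tree_monoD[OF mono] that by blast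
  qed
  \<comment> \<open>Counting: by \<open>less\<close>, exactly \<open>b\<close> values have an image
    of at most \<open>f b\<close>. Since \<open>f\<close> permutes, their images fill
    \<open>{1..f b}\<close>, so their number is also \<open>f b\<close>.\<close>
  have "{a \<in> {1..n}. f a \<le> f b} = {1..b}"
  proof (intro equalityI subsetI)
    fix a assume a: "a \<in> {a \<in> {1..n}. f a \<le> f b}"
    hence "\<not> b < a"
      using less[of a b] True assms(7) by force
    thus "a \<in> {1..b}" using a by auto
  next
    fix a assume "a \<in> {1..b}"
    thus "a \<in> {a \<in> {1..n}. f a \<le> f b}"
      using less[of b a] True assms(7) by (cases "a = b") (auto simp: less_imp_le)
  qed
  moreover have "f ` {a \<in> {1..n}. f a \<le> f b} = {1..f b}"
  proof (intro equalityI subsetI)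
    fix y assume "y \<in> f ` {a \<in> {1..n}. f a \<le> f b}"
    thus "y \<in> {1..f b}" using permutes_in_image[OF f] by auto
  next
    fix y assume y: "y \<in> {1..f b}"
    have "f b \<in> {1..n}" using permutes_in_image[OF f] True by blast
    with y have "y \<in> f ` {1..n}" unfolding permutes_image[OF f] by simp
    thus "y \<in> f ` {a \<in> {1..n}. f a \<le> f b}" using y by auto
  qed
  ultimately have "card (f ` {1..b}) = f b" by simp
  thus ?thesis
    using permutes_inj[OF f] by (simp add: card_image inj_on_subset)
next
  case False
  thus ?thesis using f by (simp add: permutes_not_in)
qed

section \<open>The statistics \<open>zeil\<close> and \<open>Rzeil\<close>\<close>

lemma zeil_subseq:
  shows "zeil \<pi> \<le> length \<pi>" "subseq (rev [Suc (length \<pi>) - zeil \<pi>..<Suc (length \<pi>)]) \<pi>"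
proof -
  let ?Z = "{k. k \<le> length \<pi> \<and> subseq (rev [Suc (length \<pi>) - k..<Suc (length \<pi>)]) \<pi>}"
  have "0 \<in> ?Z" by simp
  moreover have "finite ?Z" by simp
  ultimately have "zeil \<pi> \<in> ?Z"
    unfolding zeil_def by (metis (no_types, lifting) Max_in empty_iff)
  thus "zeil \<pi> \<le> length \<pi>" "subseq (rev [Suc (length \<pi>) - zeil \<pi>..<Suc (length \<pi>)]) \<pi>"
    by (simp_all del: upt_Suc)
qed

text \<open>The run for a smaller \<open>k\<close> is a prefix of the run for a larger one, so the
  admissible \<open>k\<close> are downward closed and the maximum acts as a threshold.\<close>

lemma subseq_rev_upt_iff:
  assumes "k \<le> length \<pi>"
  shows "subseq (rev [Suc (length \<pi>) - k..<Suc (length \<pi>)]) \<pi> \<longleftrightarrow> k \<le> zeil \<pi>"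
proof
  assume "subseq (rev [Suc (length \<pi>) - k..<Suc (length \<pi>)]) \<pi>"
  thus "k \<le> zeil \<pi>"
    using assms unfolding zeil_def by (intro Max_ge CollectI conjI) simp_all
next
  assume "k \<le> zeil \<pi>"
  hence "[Suc (length \<pi>) - zeil \<pi>..<Suc (length \<pi>)] =
      [Suc (length \<pi>) - zeil \<pi>..<Suc (length \<pi>) - k] @ [Suc (length \<pi>) - k..<Suc (length \<pi>)]"
    using zeil_subseq(1)[of \<pi>]
      upt_add_eq_append[of "Suc (length \<pi>) - zeil \<pi>" "Suc (length \<pi>) - k" k] by (simp del: upt_Suc)
  thus "subseq (rev [Suc (length \<pi>) - k..<Suc (length \<pi>)]) \<pi>"
    using zeil_subseq(2)[of \<pi>] by (metis rev_append prefix_imp_subseq prefixI subseq_order.trans)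
qed

text \<open>Apply \<open>f\<close> in one direction and its inverse in the other; both fix
  \<open>zs\<close>.\<close>

lemma subseq_map_fixed:
  assumes "inj f" "\<And>z. z \<in> set zs \<Longrightarrow> f z = z"
  shows "subseq zs (map f \<pi>) \<longleftrightarrow> subseq zs \<pi>"
proof -
  have zs: "map f zs = zs" using assms(2) by (simp add: map_idI)
  have "map (inv f) zs = zs" using assms by (simp add: map_idI inv_f_eq)
  moreover have "map (inv f) (map f \<pi>) = \<pi>" using assms(1) by simp
  ultimately show ?thesis using zs by (metis subseq_map)
qed

lemma zeil_map:
  assumes "inj f" "\<And>b. length \<pi> - zeil \<pi> \<le> b \<Longrightarrow> f b = b"
  shows "zeil (map f \<pi>) = zeil \<pi>"
proof -
  \<comment> \<open>The range ends at \<open>Suc (zeil \<pi>)\<close>: the run of that length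
    reaches down to \<open>length \<pi> - zeil \<pi>\<close>, the least value assumed to be fixed,
    and its absence bounds \<open>zeil\<close> of the image.\<close>
  have iff: "k \<le> zeil (map f \<pi>) \<longleftrightarrow> k \<le> zeil \<pi>" if "k \<le> length \<pi>" "k \<le> Suc (zeil \<pi>)" for k
  proof -
    have "subseq (rev [Suc (length \<pi>) - k..<Suc (length \<pi>)]) (map f \<pi>) \<longleftrightarrow>
        subseq (rev [Suc (length \<pi>) - k..<Suc (length \<pi>)]) \<pi>"
      using assms that by (intro subseq_map_fixed) (auto simp del: upt_Suc)
    thus ?thesis
      using subseq_rev_upt_iff[of k \<pi>] subseq_rev_upt_iff[of k "map f \<pi>"] that by simp
  qed
  have "zeil \<pi> \<le> zeil (map f \<pi>)"
    using iff[of "zeil \<pi>"] zeil_subseq(1) by simp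
  moreover have "\<not> Suc (zeil \<pi>) \<le> zeil (map f \<pi>)"
    using iff[of "Suc (zeil \<pi>)"] zeil_subseq(1)[of "map f \<pi>"] by auto
  ultimately show ?thesis by simp
qed

lemma subseq_rev [simp]: "subseq (rev xs) (rev ys) \<longleftrightarrow> subseq xs ys"
proof -
  have "subseq (rev xs) (rev ys)" if "subseq xs ys" for xs ys :: "'b list"
    using that by induction (auto intro: list_emb_append_mono)
  from this[of xs ys] this[of "rev xs" "rev ys"] show ?thesis by auto
qed

lemma Rzeil_conv_zeil: "Rzeil \<pi> = zeil (rev \<pi>)"
  by (simp add: Rzeil_def zeil_def del: upt_Suc)

lemma equidistributed_bij:
  assumes "bij_betw g X Y" "\<forall>\<theta>\<in>X. length (g \<theta>) = length \<theta>" "preserves g f X"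
  shows "equidistributed f X Y"
  unfolding equidistributed_def
proof (intro allI)
  fix n v
  have "bij_betw g {\<theta> \<in> X. length \<theta> = n \<and> f \<theta> = v} {\<theta> \<in> Y. length \<theta> = n \<and> f \<theta> = v}"
    using assms unfolding bij_betw_def preserves_def inj_on_def by force
  thus "card {\<theta> \<in> X. length \<theta> = n \<and> f \<theta> = v} = card {\<theta> \<in> Y. length \<theta> = n \<and> f \<theta> = v}"
    by (rule bij_betw_same_card)
qed

section \<open>The maps \<open>\<Phi>\<close>\<close>

lemma sorted_by_iff:
  assumes "A \<in> compositions"
  shows "\<theta> \<in> sorted_by (stack_sort \<circ> A) \<longleftrightarrow> \<theta> \<in> perms \<and> stack_sortable (A \<theta>)"
    and "\<theta> \<in> sorted_by (stack_sort \<circ> rev \<circ> A) \<longleftrightarrow> \<theta> \<in> perms \<and> stack_sortable (rev (A \<theta>))"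
  by (simp_all add: sorted_by_def stack_sortable_def compositions_set_distinct(3)[OF assms] del: upt_Suc)

text \<open>The shape condition holds at \<open>A \<theta>\<close> by the construction of
  \<open>P\<close>. \<open>compositions_map\<close> carries it back to \<open>\<theta>\<close> and
  shows that \<open>A\<close> sends the image of \<open>\<theta>\<close> to
  \<open>P (A \<theta>)\<close>.\<close>

lemma Phi_facts:
  assumes "A \<in> compositions" "\<theta> \<in> sorted_by (stack_sort \<circ> A)"
  defines "l \<equiv> lam (A \<theta>)"
  shows "l permutes {1..length \<theta>}" "tree_mono l (A \<theta>)" "tree_mono l \<theta>"
    "P_related (A \<theta>) (A (Phi A \<theta>))" "Phi A \<theta> = map l \<theta>" "Phi A \<theta> \<in> perms"
proof -
  have \<theta>: "\<theta> \<in> perms" "stack_sortable (A \<theta>)"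
    using assms sorted_by_iff by auto
  obtain \<sigma> where \<sigma>: "P_related (A \<theta>) \<sigma>"
    using P_related_ex_right[OF \<theta>(2)] by blast
  show l: "l permutes {1..length \<theta>}"
    using lam_eqI[OF \<sigma>] assms(1) by (simp add: l_def compositions_set_distinct)
  have map: "\<sigma> = map l (A \<theta>)"
    using lam_eqI[OF \<sigma>] by (simp add: l_def)
  show mono: "tree_mono l (A \<theta>)"
    by (rule P_related_tree_mono[OF \<sigma> map])
  have "distinct \<theta>" using \<theta>(1) by (simp add: perms_iff)
  note * = compositions_map[OF assms(1) this mono]
  show "tree_mono l \<theta>" using * by simp
  show Phi: "Phi A \<theta> = map l \<theta>" by (simp add: Phi_def l_def)
  show "P_related (A \<theta>) (A (Phi A \<theta>))"
    using * map \<sigma> by (simp add: Phi)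
  show "Phi A \<theta> \<in> perms" unfolding Phi by (rule map_in_perms[OF \<theta>(1) l])
qed

text \<open>Injectivity: the image determines \<open>P (A \<theta>)\<close>, hence
  \<open>A \<theta>\<close>, hence the permutation of values to be undone. Surjectivity undoes it
  for the preimage of \<open>A \<theta>'\<close> under \<open>P\<close>.\<close>

lemma bij_betw_Phi:
  assumes A: "A \<in> compositions"
  shows "bij_betw (Phi A) (sorted_by (stack_sort \<circ> A)) (sorted_by (stack_sort \<circ> rev \<circ> A))"
    (is "bij_betw _ ?X ?Y")
proof (rule bij_betw_imageI)
  show "inj_on (Phi A) ?X"
  proof (rule inj_onI)
    fix \<theta> \<theta>' assume in_X: "\<theta> \<in> ?X" "\<theta>' \<in> ?X" and eq: "Phi A \<theta> = Phi A \<theta>'"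
    note facts = Phi_facts[OF A in_X(1)] and facts' = Phi_facts[OF A in_X(2)]
    have "A \<theta> = A \<theta>'"
      using facts(4) facts'(4) eq P_related_inj by metis
    hence "map (lam (A \<theta>)) \<theta> = map (lam (A \<theta>)) \<theta>'"
      using eq by (simp add: facts(5) facts'(5))
    thus "\<theta> = \<theta>'"
      using permutes_inj[OF facts(1)] by simp
  qed
  show "Phi A ` ?X = ?Y"
  proof (intro equalityI subsetI)
    fix \<theta>' assume "\<theta>' \<in> Phi A ` ?X"
    then obtain \<theta> where "\<theta> \<in> ?X" "\<theta>' = Phi A \<theta>" by blast
    thus "\<theta>' \<in> ?Y"
      using Phi_facts(4,6)[OF A] P_related_stack_sortable sorted_by_iff[OF A] by metis
  next
    fix \<theta>' assume "\<theta>' \<in> ?Y"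
    hence \<theta>': "\<theta>' \<in> perms" "stack_sortable (rev (A \<theta>'))"
      using sorted_by_iff[OF A] by auto
    obtain \<pi> where \<pi>: "P_related \<pi> (A \<theta>')"
      using P_related_ex_left[OF \<theta>'(2)] by blast
    \<comment> \<open>The candidate preimage is \<open>map (inv l) \<theta>'\<close>. As
      \<open>inv l\<close> respects the shape of \<open>A \<theta>'\<close>, it commutes with
      \<open>A\<close>, which therefore sends the candidate to \<open>\<pi>\<close>.\<close>
    define l where "l = lam \<pi>"
    have len: "length \<pi> = length \<theta>'"
      using P_related_length[OF \<pi>] by (simp add: compositions_set_distinct[OF A])
    have l: "l permutes {1..length \<theta>'}" "A \<theta>' = map l \<pi>"
      using lam_eqI[OF \<pi>] by (simp_all add: l_def len)
    have inv: "inv l permutes {1..length \<theta>'}" by (rule permutes_inv[OF l(1)])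
    have "tree_mono (inv l) (map l \<pi>)"
      using P_related_tree_mono[OF \<pi> l(2)] permutes_inj[OF l(1)] by (intro tree_mono_inverse) simp_all
    moreover have "distinct \<theta>'" using \<theta>'(1) by (simp add: perms_iff)
    ultimately have "A (map (inv l) \<theta>') = map (inv l) (map l \<pi>)"
      using compositions_map[OF A, of \<theta>' "inv l"] l(2) by simp
    hence A\<theta>: "A (map (inv l) \<theta>') = \<pi>"
      using permutes_inj[OF l(1)] by simp
    have "map (inv l) \<theta>' \<in> ?X"
      using map_in_perms[OF \<theta>'(1) inv] P_related_stack_sortable[OF \<pi>] sorted_by_iff(1)[OF A] A\<theta> by simp
    moreover have "Phi A (map (inv l) \<theta>') = \<theta>'"
      using permutes_surj[OF l(1)] unfolding Phi_def A\<theta> l_def[symmetric]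
      by (simp add: map_idI surj_f_inv_f)
    ultimately show "\<theta>' \<in> Phi A ` ?X" by force
  qed
qed

text \<open>The first operator applied is S, so the shape condition is pulled back only as far as
  \<open>stack_sort \<theta>\<close>, where the falling top entries of \<open>\<theta>\<close> form
  the final run.\<close>

lemma Phi_preserves_zeil:
  assumes A: "A \<in> compositions" and A0: "A\<^sub>0 \<in> compositions" "same_operator A (A\<^sub>0 \<circ> stack_sort)"
  shows "preserves (Phi A) zeil (sorted_by (stack_sort \<circ> A))"
  unfolding preserves_def
proof
  fix \<theta> assume \<theta>: "\<theta> \<in> sorted_by (stack_sort \<circ> A)"
  note facts = Phi_facts[OF A \<theta>]
  let ?l = "lam (A \<theta>)"
  have perm: "\<theta> \<in> perms" using \<theta> by (simp add: sorted_by_def)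
  hence "tree_mono ?l (A\<^sub>0 (stack_sort \<theta>))"
    using facts(2) A0(2) by (simp add: same_operator_def)
  hence "tree_mono ?l (stack_sort \<theta>)"
    using compositions_map[OF A0(1)] perm by (simp add: perms_iff)
  hence "?l b = b" if "length \<theta> - zeil \<theta> \<le> b" for b
    using that perm zeil_subseq[of \<theta>] facts(1)
    by (intro top_entries_fixed[where k = "zeil \<theta>" and \<theta> = \<theta> and n = "length \<theta>"]) (simp_all add: perms_iff del: upt_Suc)
  thus "zeil (Phi A \<theta>) = zeil \<theta>"
    unfolding facts(5) by (intro zeil_map permutes_inj[OF facts(1)]) auto
qed

text \<open>The rising top entries of \<open>\<theta>\<close> stay in order under the powers of S.
  Reversal makes them falling, and the next S moves them to the end.\<close>

lemma Phi_preserves_Rzeil: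
  assumes A: "A \<in> compositions" and B0: "B\<^sub>0 \<in> compositions"
    "same_operator A (B\<^sub>0 \<circ> stack_sort \<circ> rev \<circ> (stack_sort ^^ k))"
  shows "preserves (Phi A) Rzeil (sorted_by (stack_sort \<circ> A))"
  unfolding preserves_def
proof
  fix \<theta> assume \<theta>: "\<theta> \<in> sorted_by (stack_sort \<circ> A)"
  note facts = Phi_facts[OF A \<theta>]
  let ?l = "lam (A \<theta>)" and ?\<tau> = "(stack_sort ^^ k) \<theta>" and ?n = "length \<theta>"
  have perm: "\<theta> \<in> perms" using \<theta> by (simp add: sorted_by_def)
  hence "tree_mono ?l (B\<^sub>0 (stack_sort (rev ?\<tau>)))"
    using facts(2) B0(2) by (simp add: same_operator_def)
  hence mono: "tree_mono ?l (stack_sort (rev ?\<tau>))"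
    using compositions_map[OF B0(1)] perm by (simp add: perms_iff)
  have "subseq [Suc ?n - Rzeil \<theta>..<Suc ?n] \<theta>"
    using zeil_subseq(2)[of "rev \<theta>"] unfolding Rzeil_conv_zeil length_rev subseq_rev .
  hence "subseq [Suc ?n - Rzeil \<theta>..<Suc ?n] ?\<tau>"
    using perm by (intro funpow_stack_sort_increasing_subseq) (auto simp: perms_iff simp del: upt_Suc)
  hence "subseq (rev [Suc ?n - Rzeil \<theta>..<Suc ?n]) (rev ?\<tau>)" by (simp del: upt_Suc)
  moreover have "Rzeil \<theta> \<le> ?n"
    using zeil_subseq(1)[of "rev \<theta>"] by (simp add: Rzeil_conv_zeil)
  ultimately have "?l b = b" if "?n - Rzeil \<theta> \<le> b" for b
    using that perm facts(1) mono
    by (intro top_entries_fixed[where k = "Rzeil \<theta>" and \<theta> = "rev ?\<tau>" and n = ?n]) (simp_all add: perms_iff del: upt_Suc)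
  \<comment> \<open>Being fixed concerns values and not positions, so what was found from
    \<open>rev ?\<tau>\<close> applies to \<open>rev \<theta>\<close>.\<close>
  hence "zeil (map ?l (rev \<theta>)) = zeil (rev \<theta>)"
    by (intro zeil_map permutes_inj[OF facts(1)]) (auto simp: Rzeil_conv_zeil)
  thus "Rzeil (Phi A \<theta>) = Rzeil \<theta>"
    unfolding facts(5) by (simp add: Rzeil_conv_zeil rev_map)
qed

theorem theorem4p13:
  fixes A :: "nat list \<Rightarrow> nat list"
  assumes "A \<in> compositions"
  defines "X \<equiv> sorted_by (stack_sort \<circ> A)"
    and "Y \<equiv> sorted_by (stack_sort \<circ> rev \<circ> A)"
    and "ends_with_S \<equiv> \<exists>A\<^sub>0\<in>compositions. same_operator A (A\<^sub>0 \<circ> stack_sort)"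
    and "ends_with_S_R_Sk \<equiv>
      \<exists>B\<^sub>0\<in>compositions. \<exists>k\<ge>1. same_operator A (B\<^sub>0 \<circ> stack_sort \<circ> rev \<circ> (stack_sort ^^ k))"
  shows
    "(\<forall>n. card {\<theta> \<in> X. length \<theta> = n} = card {\<theta> \<in> Y. length \<theta> = n}) \<and>
     equidistributed rl_max_count X Y \<and>
     equidistributed rl_max_positions X Y \<and>
     equidistributed lr_max_count X Y \<and>
     equidistributed lr_max_positions X Y \<and>
     equidistributed updown_word X Y \<and>
     (\<forall>f :: nat list \<Rightarrow> 'a. determined_by_updown f \<longrightarrow> equidistributed f X Y) \<and>
     (ends_with_S \<longrightarrow> equidistributed zeil X Y) \<and>
     (ends_with_S_R_Sk \<longrightarrow> equidistributed Rzeil X Y) \<and>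
     bij_betw (Phi A) X Y \<and>
     (\<forall>\<theta>\<in>X. length (Phi A \<theta>) = length \<theta>) \<and>
     preserves (Phi A) rl_max_count X \<and>
     preserves (Phi A) rl_max_positions X \<and>
     preserves (Phi A) lr_max_count X \<and>
     preserves (Phi A) lr_max_positions X \<and>
     preserves (Phi A) updown_word X \<and>
     (\<forall>f :: nat list \<Rightarrow> 'a. determined_by_updown f \<longrightarrow> preserves (Phi A) f X) \<and>
     (ends_with_S \<longrightarrow> preserves (Phi A) zeil X) \<and>
     (ends_with_S_R_Sk \<longrightarrow> preserves (Phi A) Rzeil X)"
proof -
  note facts = Phi_facts[OF assms(1), folded X_def]
  have bij: "bij_betw (Phi A) X Y"
    unfolding X_def Y_def by (rule bij_betw_Phi[OF assms(1)])
  have len: "\<forall>\<theta>\<in>X. length (Phi A \<theta>) = length \<theta>"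
    by (simp add: Phi_def)
  have lr: "preserves (Phi A) lr_max_positions X"
    and rl: "preserves (Phi A) rl_max_positions X"
    and ud: "preserves (Phi A) updown_word X"
    using facts(3,5)
    by (auto simp: preserves_def lr_max_positions_map rl_max_positions_map updown_word_map)
  have lrc: "preserves (Phi A) lr_max_count X" and rlc: "preserves (Phi A) rl_max_count X"
    using lr rl by (simp_all add: preserves_def lr_max_count_def rl_max_count_def)
  have f: "preserves (Phi A) f X" if "determined_by_updown f" for f :: "nat list \<Rightarrow> 'a"
    unfolding preserves_def
  proof
    fix \<theta> assume \<theta>: "\<theta> \<in> X"
    hence "\<theta> \<in> perms" by (simp add: X_def sorted_by_def)
    thus "f (Phi A \<theta>) = f \<theta>"
      using that[unfolded determined_by_updown_def, rule_format, of "Phi A \<theta>" \<theta>]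
        facts(6)[OF \<theta>] \<theta> ud len by (auto simp: preserves_def)
  qed
  have z: "preserves (Phi A) zeil X" if ends_with_S
    using that Phi_preserves_zeil[OF assms(1)] unfolding ends_with_S_def X_def by blast
  have Rz: "preserves (Phi A) Rzeil X" if ends_with_S_R_Sk
    using that Phi_preserves_Rzeil[OF assms(1)] unfolding ends_with_S_R_Sk_def X_def by blast
  note eq = equidistributed_bij[OF bij len]
  \<comment> \<open>For a constant statistic, equidistribution is equality of the counts in each
    size.\<close>
  have "equidistributed (\<lambda>_. ()) X Y"
    by (rule eq) (simp add: preserves_def)
  hence "\<forall>n. card {\<theta> \<in> X. length \<theta> = n} = card {\<theta> \<in> Y. length \<theta> = n}"
    by (simp add: equidistributed_def)
  thus ?thesis
    using bij len lr rl ud lrc rlc f z Rz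
      eq[OF lr] eq[OF rl] eq[OF ud] eq[OF lrc] eq[OF rlc] eq[OF f] eq[OF z] eq[OF Rz]
    by (intro conjI; blast)
qed

end
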